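(* Let $r,m,n\ge 1$ be integers, and let $p_1,\dots,p_r$ and $g_1,\dots,g_m$ be SOS-convex polynomials on $\mathbb{R}^n$ such that $\mathcal F:=\{x\in\mathbb{R}^n : g_i(x)\le 0,\ i=1,\dots,m\}\neq\emptyset$. Let $d$ be the smallest even number such that $d\ge\max\{\max_j\deg p_j,\ \max_i\deg g_i\}$. Consider $$(P)\quad \inf_{x\in\mathcal F}\ \max_{1\le j\le r}p_j(x)$$ and $$(D)\quad \sup\Big\{\mu : \sum_{j=1}^r\delta_jp_j+\sum_{i=1}^m\lambda_ig_i-\mu\in\Sigma^2_d,\ \delta\in\Delta,\ \lambda\in\mathbb{R}^m_+,\ \mu\in\mathbb{R}\Big\}.$$ If the Slater condition holds, that is, $\{x\in\mathbb{R}^n : g_i(x)<0,\ i=1,\dots,m\}\neq\emptyset$, then $$\inf(P)=\max(D).$$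
   Context: $\mathbb{R}^k_+$ denotes the set of vectors in $\mathbb{R}^k$ with nonnegative coordinates, and $\Delta:=\{\delta\in\mathbb{R}^r_+ : \sum_{j=1}^r\delta_j=1\}$. A real polynomial $f$ on $\mathbb{R}^n$ is a sum of squares if $f=\sum_{l=1}^s f_l^2$ for some real polynomials $f_1,\dots,f_s$; $\Sigma^2_d$ is the set of sum of squares real polynomials on $\mathbb{R}^n$ of degree at most $d$. A real polynomial $f$ on $\mathbb{R}^n$ is SOS-convex if its Hessian is an SOS-matrix polynomial, i.e. $\nabla^2 f(x)=H(x)H(x)^T$ for some $s\in\mathbb{N}$ and some matrix polynomial $H\in\mathbb{R}[x]^{n\times s}$. $\inf(P)$ denotes the optimal value of $(P)$; writing $\max(D)$ for the optimal value of $(D)$ means that the supremum in $(D)$ is attained.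
   Formalization: Attainment in (D) is asserted only when inf(P) is not −∞; if inf(P) = −∞ (e.g. p(x) = x, g = −1), (D) has no feasible point, so its supremum cannot be attained, and only the equality inf(P) = sup(D) = −∞ is stated. *)

theory Defs
  imports "HOL-Analysis.Analysis" "HOL-Library.Poly_Mapping"
begin

text \<open>
  Real polynomials in the variables indexed by the finite type \<open>'n\<close>: finitely supported maps from
  exponent vectors to coefficients, with the convolution product of
  \<^theory>\<open>HOL-Library.Poly_Mapping\<close>. Evaluation is on the space \<open>real ^ 'n\<close>.
\<close>

type_synonym 'n rpoly = "('n \<Rightarrow>\<^sub>0 nat) \<Rightarrow>\<^sub>0 real"

definition const_poly :: "real \<Rightarrow> 'n rpoly" where
  "const_poly c = Poly_Mapping.single 0 c"

definition eval_poly :: "'n::finite rpoly \<Rightarrow> real ^ 'n \<Rightarrow> real" where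
  "eval_poly f x =
    (\<Sum>a\<in>Poly_Mapping.keys f. Poly_Mapping.lookup f a * (\<Prod>i\<in>UNIV. (x $ i) ^ Poly_Mapping.lookup a i))"

definition exp_degree :: "('n::finite \<Rightarrow>\<^sub>0 nat) \<Rightarrow> nat" where
  "exp_degree a = (\<Sum>i\<in>UNIV. Poly_Mapping.lookup a i)"

text \<open>Total degree; the zero polynomial is given degree 0.\<close>

definition poly_degree :: "'n::finite rpoly \<Rightarrow> nat" where
  "poly_degree f = Max (insert 0 (exp_degree ` Poly_Mapping.keys f))"

text \<open>
  The formal partial derivative. For an exponent vector \<open>a\<close> with \<open>a i = 0\<close> the truncated
  subtraction is harmless, since the coefficient vanishes.
\<close>

definition partial_poly :: "'n \<Rightarrow> 'n rpoly \<Rightarrow> 'n rpoly" where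
  "partial_poly i f =
    (\<Sum>a\<in>Poly_Mapping.keys f.
      Poly_Mapping.single (a - Poly_Mapping.single i 1)
        (of_nat (Poly_Mapping.lookup a i) * Poly_Mapping.lookup f a))"

definition hessian_poly :: "'n rpoly \<Rightarrow> 'n \<Rightarrow> 'n \<Rightarrow> 'n rpoly" where
  "hessian_poly f i j = partial_poly i (partial_poly j f)"

text \<open>
  A matrix polynomial \<open>M\<close> with rows and columns indexed by \<open>'n\<close> is an SOS-matrix polynomial if
  \<open>M = H H\<^sup>T\<close> for a matrix polynomial \<open>H\<close> with columns indexed by \<open>{..<s}\<close>. As \<open>s\<close> is quantified,
  matrices are functions of their indices.
\<close>

definition sos_matrix :: "('n \<Rightarrow> 'n \<Rightarrow> 'n rpoly) \<Rightarrow> bool" where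
  "sos_matrix M \<longleftrightarrow>
    (\<exists>(s::nat) (H :: 'n \<Rightarrow> nat \<Rightarrow> 'n rpoly). \<forall>i j. M i j = (\<Sum>k<s. H i k * H j k))"

definition sos_convex :: "'n rpoly \<Rightarrow> bool" where
  "sos_convex f \<longleftrightarrow> sos_matrix (hessian_poly f)"

definition sum_of_squares :: "'n rpoly \<Rightarrow> bool" where
  "sum_of_squares f \<longleftrightarrow> (\<exists>(s::nat) (q :: nat \<Rightarrow> 'n rpoly). f = (\<Sum>l<s. (q l)\<^sup>2))"

definition SOS_le :: "nat \<Rightarrow> 'n::finite rpoly set" where
  "SOS_le d = {f. sum_of_squares f \<and> poly_degree f \<le> d}"

definition nonneg_orthant :: "(real ^ 'k) set" where
  "nonneg_orthant = {v. \<forall>i. 0 \<le> v $ i}"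

definition unit_simplex :: "(real ^ 'r::finite) set" where
  "unit_simplex = {\<delta> \<in> nonneg_orthant. (\<Sum>j\<in>UNIV. \<delta> $ j) = 1}"

definition feasible_set :: "('m \<Rightarrow> 'n::finite rpoly) \<Rightarrow> (real ^ 'n) set" where
  "feasible_set g = {x. \<forall>i. eval_poly (g i) x \<le> 0}"

definition inf_P :: "('r::finite \<Rightarrow> 'n::finite rpoly) \<Rightarrow> ('m \<Rightarrow> 'n rpoly) \<Rightarrow> ereal" where
  "inf_P p g = (INF x\<in>feasible_set g. ereal (MAX j. eval_poly (p j) x))"

text \<open>The values \<open>\<mu>\<close> over which the supremum in the dual problem is taken.\<close>

definition dual_values ::
  "('r::finite \<Rightarrow> 'n::finite rpoly) \<Rightarrow> ('m::finite \<Rightarrow> 'n rpoly) \<Rightarrow> nat \<Rightarrow> real set" where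
  "dual_values p g d =
    {\<mu>. \<exists>\<delta> \<in> unit_simplex. \<exists>lam \<in> nonneg_orthant.
      (\<Sum>j\<in>UNIV. const_poly (\<delta> $ j) * p j) + (\<Sum>i\<in>UNIV. const_poly (lam $ i) * g i) - const_poly \<mu>
        \<in> SOS_le d}"

text \<open>With \<open>Sup {} = -\<infinity>\<close>, this is \<open>-\<infinity>\<close> if the dual problem has no feasible point.\<close>

definition sup_D ::
  "('r::finite \<Rightarrow> 'n::finite rpoly) \<Rightarrow> ('m::finite \<Rightarrow> 'n rpoly) \<Rightarrow> nat \<Rightarrow> ereal" where
  "sup_D p g d = (SUP \<mu>\<in>dual_values p g d. ereal \<mu>)"

end

theory Submission
  imports Defs "HOL-Computational_Algebra.Polynomial"
begin

text \<open>
  Convex duality under the Slater condition yields multipliers for which the Lagrangian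
  \<open>L = \<Sum> \<delta>\<^sub>j p\<^sub>j + \<Sum> \<lambda>\<^sub>i g\<^sub>i - inf(P)\<close> is nonnegative on the whole space, and \<open>L\<close> is again
  SOS-convex. A convex polynomial that is bounded below attains its minimum, since modulo its
  directions of constancy its sublevel sets are compact. Taylor's formula with integral remainder at
  a minimizer, where the linear term vanishes, exhibits \<open>L\<close> as a nonnegative constant plus an
  integral of squares, which is itself a sum of squares.
\<close>

section \<open>Evaluation and partial derivatives of polynomials\<close>

text \<open>A nonnegative polynomial need not be a sum of squares. SOS-convexity closes this gap
  because the factor \<open>H\<close> of the Hessian makes the second derivative along every segment
  a sum of squares. The first-order term is the obstacle: a nonzero linear form takes negative
  values, so the expansion must be centred at an actual minimizer of \<open>L\<close>, and a finite
  infimum alone would not do. A minimizer of (P) is never sought, since its value enters only as a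
  lower bound. Integrating over the segment parameter keeps the number of squares finite: the powers
  of the parameter integrate to a positive semidefinite moment matrix. Convexity and Taylor
  expansion concern functions while (D) concerns formal polynomials, so identities are carried over
  by \<open>eval_poly_inject\<close>.\<close>

definition monom_eval :: "('n::finite \<Rightarrow>\<^sub>0 nat) \<Rightarrow> real ^ 'n \<Rightarrow> real" where
  "monom_eval a x = (\<Prod>i\<in>UNIV. (x $ i) ^ Poly_Mapping.lookup a i)"

lemma eval_poly_superset:
  assumes "finite A" "Poly_Mapping.keys f \<subseteq> A"
  shows "eval_poly f x = (\<Sum>a\<in>A. Poly_Mapping.lookup f a * monom_eval a x)"
  unfolding eval_poly_def monom_eval_def
  by (rule sum.mono_neutral_left) (use assms in \<open>auto simp: in_keys_iff\<close>)

lemma eval_poly_zero [simp]: "eval_poly 0 x = 0"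
  by (simp add: eval_poly_def)

lemma eval_poly_add [simp]: "eval_poly (f + g) x = eval_poly f x + eval_poly g x"
proof -
  let ?A = "Poly_Mapping.keys f \<union> Poly_Mapping.keys g"
  have "eval_poly h x = (\<Sum>a\<in>?A. Poly_Mapping.lookup h a * monom_eval a x)"
    if "Poly_Mapping.keys h \<subseteq> ?A" for h
    using that by (intro eval_poly_superset) auto
  from this[of f] this[of g] this[OF Poly_Mapping.keys_add] show ?thesis
    by (simp add: lookup_add distrib_right sum.distrib)
qed

lemma eval_poly_sum [simp]: "eval_poly (sum f A) x = (\<Sum>a\<in>A. eval_poly (f a) x)"
  by (induction A rule: infinite_finite_induct) auto

lemma eval_poly_uminus [simp]: "eval_poly (- f) x = - eval_poly f x"
  using eval_poly_add[of f "-f" x] by simp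

lemma eval_poly_diff [simp]: "eval_poly (f - g) x = eval_poly f x - eval_poly g x"
  using eval_poly_add[of f "-g" x] by simp

lemma eval_poly_single: "eval_poly (Poly_Mapping.single a c) x = c * monom_eval a x"
  by (simp add: eval_poly_def monom_eval_def)

lemma monom_eval_0 [simp]: "monom_eval 0 x = 1"
  by (simp add: monom_eval_def)

lemma monom_eval_add: "monom_eval (a + b) x = monom_eval a x * monom_eval b x"
  by (simp add: monom_eval_def lookup_add power_add prod.distrib)

lemma eval_poly_const [simp]: "eval_poly (const_poly c) x = c"
  by (simp add: const_poly_def eval_poly_single)

lemma eval_poly_1 [simp]: "eval_poly 1 x = 1"
  using eval_poly_const[of 1 x] by (simp add: const_poly_def)

lemma rpoly_decompose:
  "f = (\<Sum>a\<in>Poly_Mapping.keys f. Poly_Mapping.single a (Poly_Mapping.lookup f a))"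
  by (rule poly_mapping_eqI)
     (simp add: lookup_sum lookup_single when_def sum.delta in_keys_iff)

lemma eval_poly_mult [simp]: "eval_poly (f * g) x = eval_poly f x * eval_poly g x"
proof -
  define F where "F = Poly_Mapping.keys f"
  define G where "G = Poly_Mapping.keys g"
  define u where "u a = Poly_Mapping.lookup f a" for a
  define v where "v a = Poly_Mapping.lookup g a" for a
  have f: "f = (\<Sum>a\<in>F. Poly_Mapping.single a (u a))" and g: "g = (\<Sum>a\<in>G. Poly_Mapping.single a (v a))"
    unfolding F_def G_def u_def v_def by (rule rpoly_decompose)+
  show ?thesis
    unfolding f g
    by (simp add: sum_product mult_single eval_poly_single monom_eval_add mult_ac)
qed

lemma eval_poly_power [simp]: "eval_poly (f ^ k) x = eval_poly f x ^ k"
  by (induction k) auto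

definition var_poly :: "'n \<Rightarrow> 'n::finite rpoly" where
  "var_poly i = Poly_Mapping.single (Poly_Mapping.single i 1) 1"

lemma eval_poly_var [simp]: "eval_poly (var_poly i) x = x $ i"
proof -
  have "(\<Prod>j\<in>UNIV. x $ j ^ (1 when i = j)) = (\<Prod>j\<in>UNIV. if i = j then x $ j else 1)"
    by (intro prod.cong) auto
  then show ?thesis
    by (simp add: var_poly_def eval_poly_single monom_eval_def lookup_single)
qed

text \<open>Only exponents with a positive \<open>i\<close>-th entry contribute, and on these,
  lowering that entry is injective, so each coefficient of the derivative comes from a single term
  of \<open>f\<close>. Linearity facts then reduce to comparing coefficients.\<close>

lemma lookup_partial_poly:
  "Poly_Mapping.lookup (partial_poly i f) a =
     of_nat (Suc (Poly_Mapping.lookup a i)) * Poly_Mapping.lookup f (a + Poly_Mapping.single i 1)"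
proof -
  let ?e = "Poly_Mapping.single i (1::nat)"
  have eq: "(a' - ?e = a \<and> Poly_Mapping.lookup a' i \<noteq> 0) \<longleftrightarrow> a' = a + ?e" for a' 
  proof
    assume h: "a' - ?e = a \<and> Poly_Mapping.lookup a' i \<noteq> 0"
    show "a' = a + ?e"
      by (rule poly_mapping_eqI) (use h in \<open>auto simp: lookup_add lookup_minus lookup_single when_def\<close>)
  qed (auto simp: lookup_add lookup_single)
  have "Poly_Mapping.lookup (partial_poly i f) a = (\<Sum>a'\<in>Poly_Mapping.keys f.
      if a' = a + ?e then of_nat (Poly_Mapping.lookup a' i) * Poly_Mapping.lookup f a' else 0)"
    unfolding partial_poly_def lookup_sum lookup_single when_def
  proof (intro sum.cong refl)
    fix a'
    show "(if a' - ?e = a then of_nat (Poly_Mapping.lookup a' i) * Poly_Mapping.lookup f a' else 0) =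
      (if a' = a + ?e then of_nat (Poly_Mapping.lookup a' i) * Poly_Mapping.lookup f a' else 0)"
      using eq[of a'] by (cases "Poly_Mapping.lookup a' i = 0") (simp_all only: simp_thms mult_zero_left of_nat_0 if_cancel split: if_split)
  qed
  also have "\<dots> = of_nat (Suc (Poly_Mapping.lookup a i)) * Poly_Mapping.lookup f (a + ?e)"
    by (subst sum.delta) (auto simp: lookup_add lookup_single in_keys_iff)
  finally show ?thesis .
qed

lemma partial_poly_add: "partial_poly i (f + g) = partial_poly i f + partial_poly i g"
  by (rule poly_mapping_eqI) (simp add: lookup_partial_poly lookup_add algebra_simps)

lemma partial_poly_0 [simp]: "partial_poly i 0 = 0"
  by (rule poly_mapping_eqI) (simp add: lookup_partial_poly)

lemma lookup_const_poly_mult: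
  "Poly_Mapping.lookup (const_poly c * f) a = c * Poly_Mapping.lookup f a"
proof -
  have "Poly_Mapping.map ((*) c) f = const_poly c * f"
    unfolding const_poly_def by (rule mult_map_scale_conv_mult)
  then show ?thesis
    by (simp add: Poly_Mapping.map.rep_eq when_def flip: \<open>Poly_Mapping.map ((*) c) f = _\<close>)
qed

lemma partial_poly_const_mult: "partial_poly i (const_poly c * f) = const_poly c * partial_poly i f"
  by (rule poly_mapping_eqI) (simp add: lookup_partial_poly lookup_const_poly_mult)

lemma partial_poly_const [simp]: "partial_poly i (const_poly c) = 0"
  by (rule poly_mapping_eqI) 
    (auto simp: lookup_partial_poly const_poly_def lookup_single when_def poly_mapping_eq_iff fun_eq_iff lookup_add)

lemma has_derivative_monom_eval:
  "(monom_eval a has_derivative (\<lambda>h. \<Sum>i\<in>UNIV.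
      real (Poly_Mapping.lookup a i) * monom_eval (a - Poly_Mapping.single i 1) x * h $ i)) (at x)"
proof -
  have *: "real (Poly_Mapping.lookup a i) * monom_eval (a - Poly_Mapping.single i 1) x
      = real (Poly_Mapping.lookup a i) * x $ i ^ (Poly_Mapping.lookup a i - 1) *
        (\<Prod>j\<in>UNIV - {i}. x $ j ^ Poly_Mapping.lookup a j)" for i
    unfolding monom_eval_def
    by (subst prod.remove[of _ i]) (auto simp: lookup_minus lookup_single intro!: prod.cong)
  have "((\<lambda>x. x $ i) has_derivative (\<lambda>h. h $ i)) (at x)" for i
    by (rule bounded_linear_imp_has_derivative) (rule bounded_linear_vec_nth)
  then show ?thesis
    unfolding * unfolding monom_eval_def
    by (intro derivative_eq_intros | assumption | rule refl)+ (auto simp: fun_eq_iff mult_ac intro!: sum.cong)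
qed

lemma has_derivative_eval_poly:
  "(eval_poly f has_derivative (\<lambda>h. \<Sum>i\<in>UNIV. eval_poly (partial_poly i f) x * h $ i)) (at x)"
proof -
  have e: "eval_poly f = (\<lambda>x. \<Sum>a\<in>Poly_Mapping.keys f. Poly_Mapping.lookup f a * monom_eval a x)"
    by (simp add: eval_poly_def monom_eval_def fun_eq_iff)
  show ?thesis
    unfolding e
    by (rule has_derivative_eq_rhs,
        (rule has_derivative_sum has_derivative_mult_right has_derivative_monom_eval)+,
        simp add: fun_eq_iff partial_poly_def eval_poly_single sum_distrib_left sum_distrib_right,
        subst sum.swap, simp add: mult_ac)
qed

section \<open>Equality of polynomials from equality of their values\<close>

lemma eval_poly_at_0: "eval_poly f 0 = Poly_Mapping.lookup f 0"
proof -
  have m: "monom_eval a 0 = (if a = 0 then 1 else 0)" for a :: "'n::finite \<Rightarrow>\<^sub>0 nat"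
    by (auto simp: monom_eval_def poly_mapping_eq_iff fun_eq_iff prod_zero_iff)
  show ?thesis
    by (subst eval_poly_superset[of "insert 0 (Poly_Mapping.keys f)"])
       (simp_all add: m if_distrib sum.delta subset_insertI del: sum.insert cong: if_cong)
qed

text \<open>Up to a positive factor the coefficient at \<open>b\<close> is an iterated partial
  derivative at 0, and the partial derivatives of a vanishing function vanish again. Each induction
  step removes one variable from \<open>b\<close>.\<close>

lemma lookup_eq_0_if_eval_poly_eq_0:
  assumes "\<And>x. eval_poly f x = 0"
  shows "Poly_Mapping.lookup f b = 0"
  using assms
proof (induction "exp_degree b" arbitrary: f b)
  case 0
  then have "b = 0"
    by (auto simp: exp_degree_def poly_mapping_eq_iff fun_eq_iff)
  with 0 show ?case
    using eval_poly_at_0[of f] by simp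
next
  case (Suc k)
  then obtain i where i: "Poly_Mapping.lookup b i \<noteq> 0"
    unfolding exp_degree_def by (metis sum.neutral nat.distinct(1))
  let ?e = "Poly_Mapping.single i (1::nat)"
  define a where "a = b - ?e"
  have b: "b = a + ?e"
    by (rule poly_mapping_eqI) (use i in \<open>auto simp: a_def lookup_add lookup_minus lookup_single when_def\<close>)
  have "k = exp_degree a"
    using Suc(2) unfolding b exp_degree_def
    by (simp add: lookup_add lookup_single sum.distrib when_def)
  moreover have "eval_poly (partial_poly i f) x = 0" for x
  proof -
    have "eval_poly f = (\<lambda>_. 0)"
      using Suc(3) by auto
    then have "(eval_poly f has_derivative (\<lambda>_. 0)) (at x)"
      by simp
    from fun_cong[OF has_derivative_unique[OF this has_derivative_eval_poly], of "axis i 1"]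
    show ?thesis
      by (simp add: axis_def if_distrib cong: if_cong)
  qed
  ultimately have "Poly_Mapping.lookup (partial_poly i f) a = 0"
    using Suc(1) by blast
  then show ?case
    by (simp add: lookup_partial_poly b)
qed

text \<open>Lets identities between formal polynomials, such as decompositions into squares, be
  checked pointwise over the reals.\<close>

lemma eval_poly_inject:
  assumes "\<And>x. eval_poly f x = eval_poly g x"
  shows "f = g"
proof -
  have "Poly_Mapping.lookup (f - g) b = 0" for b
    by (rule lookup_eq_0_if_eval_poly_eq_0) (simp add: assms)
  then show ?thesis
    by (intro poly_mapping_eqI) (simp add: lookup_minus)
qed

section \<open>Sums of squares and positive semidefinite forms\<close>

text \<open>Completing the square in the last variable splits off one square and leaves a positive
  semidefinite form in the remaining variables.\<close>

lemma psd_factorization: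
  fixes M :: "nat \<Rightarrow> nat \<Rightarrow> real"
  assumes "\<And>a b. M a b = M b a"
    and "\<And>v. 0 \<le> (\<Sum>a<n. \<Sum>b<n. M a b * v a * v b)"
  shows "\<exists>L :: nat \<Rightarrow> nat \<Rightarrow> real. \<forall>a<n. \<forall>b<n. M a b = (\<Sum>k<n. L k a * L k b)"
  using assms
proof (induction n arbitrary: M)
  case (Suc n)
  define m where "m = M n n"
  have expand: "(\<Sum>a<Suc n. \<Sum>b<Suc n. M a b * v a * v b) =
      (\<Sum>a<n. \<Sum>b<n. M a b * v a * v b) + 2 * v n * (\<Sum>a<n. M a n * v a) + m * (v n)\<^sup>2" for v
  proof -
    have "(\<Sum>b<n. M n b * v n * v b) = v n * (\<Sum>a<n. M a n * v a)"
      by (simp only: sum_distrib_left) (intro sum.cong refl, simp add: Suc(2)[of n])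
    moreover have "(\<Sum>a<n. M a n * v a * v n) = v n * (\<Sum>a<n. M a n * v a)"
      by (simp only: sum_distrib_left) (intro sum.cong refl, simp)
    ultimately show ?thesis
      by (simp add: sum.distrib m_def power2_eq_square)
  qed
  have Q: "0 \<le> (\<Sum>a<n. \<Sum>b<n. M a b * v a * v b) + 2 * v n * (\<Sum>a<n. M a n * v a) + m * (v n)\<^sup>2" for v
    using Suc(3)[of v] unfolding expand .
  have m: "0 \<le> m"
    using Q[of "\<lambda>a. if a = n then 1 else 0"] by simp
  have m0: "M a n = 0" if "m = 0" "a < n" for a
  proof (rule ccontr)
    assume ne: "M a n \<noteq> 0"
    \<comment> \<open>Chosen so that the form at \<open>w(n := c)\<close> equals
      \<open>M a a + 2 * c * M a n = -1\<close>; with \<open>m = 0\<close> there is no term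
      quadratic in \<open>c\<close> to compensate.\<close>
    define c where "c = - (M a a + 1) / (2 * M a n)"
    define w :: "nat \<Rightarrow> real" where "w b = (if b = a then 1 else 0)" for b
    have "(\<Sum>x<n. \<Sum>y<n. M x y * w x * w y) = (\<Sum>x<n. \<Sum>y<n. if y = a then if x = a then M x y else 0 else 0)"
      by (intro sum.cong refl) (simp add: w_def)
    also have "\<dots> = M a a"
      using that by simp
    finally have 1: "(\<Sum>x<n. \<Sum>y<n. M x y * w x * w y) = M a a" .
    have "(\<Sum>x<n. M x n * w x) = (\<Sum>x<n. if x = a then M x n else 0)"
      by (intro sum.cong refl) (simp add: w_def)
    also have "\<dots> = M a n"
      using that by simp
    finally have "0 \<le> M a a + 2 * c * M a n"
      using Q[of "w(n := c)"] 1 that(1) by simp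
    then show False
      using ne by (simp add: c_def field_simps)
  qed
  txt \<open>The Schur complement; for \<open>m = 0\<close> the junk value of the division is harmless by \<open>m0\<close>.\<close>
  define M' where "M' a b = M a b - M a n * M b n / m" for a b
  have "\<exists>L :: nat \<Rightarrow> nat \<Rightarrow> real. \<forall>a<n. \<forall>b<n. M' a b = (\<Sum>k<n. L k a * L k b)"
  proof (rule Suc.IH)
    show "M' a b = M' b a" for a b
      using Suc(2)[of a b] by (simp add: M'_def)
    fix v :: "nat \<Rightarrow> real"
    define S where "S = (\<Sum>a<n. M a n * v a)"
    \<comment> \<open>For positive \<open>m\<close>, the value \<open>- S / m\<close> minimizes the
      form in the last variable. For \<open>m = 0\<close> division by zero makes it 0, and
      \<open>S * S / m\<close> vanishes with it.\<close>
    have "0 \<le> (\<Sum>a<n. \<Sum>b<n. M a b * v a * v b) + 2 * (- S / m) * S + m * (- S / m)\<^sup>2"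
      using Q[of "v(n := - S / m)"] by (simp add: S_def)
    also have "\<dots> = (\<Sum>a<n. \<Sum>b<n. M a b * v a * v b) - S * S / m"
      by (cases "m = 0") (simp_all add: field_simps power2_eq_square)
    also have "\<dots> = (\<Sum>a<n. \<Sum>b<n. M' a b * v a * v b)"
    proof -
      have "S * S / m = (\<Sum>a<n. \<Sum>b<n. M a n * M b n / m * v a * v b)"
        unfolding S_def sum_product sum_divide_distrib by (intro sum.cong refl) simp
      then show ?thesis
        by (simp add: M'_def left_diff_distrib sum_subtractf)
    qed
    finally show "0 \<le> (\<Sum>a<n. \<Sum>b<n. M' a b * v a * v b)" .
  qed
  then obtain L where L: "\<And>a b. a < n \<Longrightarrow> b < n \<Longrightarrow> M' a b = (\<Sum>k<n. L k a * L k b)"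
    by blast
  \<comment> \<open>The last row is the square that was split off and restores the term
    \<open>M a n * M b n / m\<close>; the other rows are padded with 0 in column \<open>n\<close>.
    For \<open>m = 0\<close> the last row is zero, in agreement with \<open>m0\<close>.\<close>
  define L' where "L' k a = (if k < n then if a < n then L k a else 0 else M a n / sqrt m)" for k a
  have "M a b = (\<Sum>k<Suc n. L' k a * L' k b)" if "a < Suc n" "b < Suc n" for a b
  proof -
    have last: "L' n a * L' n b = M a n * M b n / m"
      using m by (simp add: L'_def)
    show ?thesis
    proof (cases "a < n \<and> b < n")
      case True
      then have "(\<Sum>k<n. L' k a * L' k b) = M' a b"
        by (simp add: L'_def L)
      then show ?thesis
        by (simp add: last M'_def)
    next
      case False
      then have "(\<Sum>k<n. L' k a * L' k b) = 0"
        by (intro sum.neutral) (auto simp: L'_def)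
      moreover have "M a b = M a n * M b n / m"
        using False that m0 Suc(2)[of n b]
        by (cases "m = 0"; cases "a = n"; cases "b = n") (simp_all add: m_def less_Suc_eq)
      ultimately show ?thesis
        by (simp add: last)
    qed
  qed
  then show ?case
    by blast
qed simp

text \<open>A factorization of the matrix turns the form into \<open>n\<close> squares, one for each
  row of \<open>L\<close> applied to the vector of polynomials \<open>c\<close>.\<close>

lemma sum_of_squares_psd_form:
  fixes M :: "nat \<Rightarrow> nat \<Rightarrow> real" and c :: "nat \<Rightarrow> 'n::finite rpoly"
  assumes "\<And>a b. M a b = M b a"
    and "\<And>v. 0 \<le> (\<Sum>a<n. \<Sum>b<n. M a b * v a * v b)"
  shows "sum_of_squares (\<Sum>a<n. \<Sum>b<n. const_poly (M a b) * c a * c b)"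
proof -
  obtain L where L: "\<And>a b. a < n \<Longrightarrow> b < n \<Longrightarrow> M a b = (\<Sum>k<n. L k a * L k b)"
    using psd_factorization[OF assms] by blast
  have "(\<Sum>a<n. \<Sum>b<n. const_poly (M a b) * c a * c b) =
      (\<Sum>k<n. (\<Sum>a<n. const_poly (L k a) * c a)\<^sup>2)"
  proof (rule eval_poly_inject)
    fix x
    have "(\<Sum>a<n. \<Sum>b<n. M a b * eval_poly (c a) x * eval_poly (c b) x) =
      (\<Sum>a<n. \<Sum>b<n. \<Sum>k<n. (L k a * eval_poly (c a) x) * (L k b * eval_poly (c b) x))"
      by (intro sum.cong refl) (simp add: L sum_distrib_right sum_distrib_left mult_ac)
    also have "\<dots> = (\<Sum>a<n. \<Sum>k<n. \<Sum>b<n. (L k a * eval_poly (c a) x) * (L k b * eval_poly (c b) x))"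
      by (intro sum.cong refl sum.swap)
    also have "\<dots> = (\<Sum>k<n. \<Sum>a<n. \<Sum>b<n. (L k a * eval_poly (c a) x) * (L k b * eval_poly (c b) x))"
      by (rule sum.swap)
    finally show "eval_poly (\<Sum>a<n. \<Sum>b<n. const_poly (M a b) * c a * c b) x =
        eval_poly (\<Sum>k<n. (\<Sum>a<n. const_poly (L k a) * c a)\<^sup>2) x"
      by (simp add: power2_eq_square sum_product)
  qed
  then show ?thesis
    unfolding sum_of_squares_def by (intro exI)
qed

section \<open>Closure of sums of squares under addition and integration\<close>

lemma sum_of_squares_power2: "sum_of_squares (q\<^sup>2)"
  unfolding sum_of_squares_def by (intro exI[of _ 1] exI[of _ "\<lambda>_. q"]) simp

lemma sum_of_squares_0: "sum_of_squares 0"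
  unfolding sum_of_squares_def by (intro exI[of _ 0]) simp

lemma sum_lessThan_add_cases:
  fixes F G :: "nat \<Rightarrow> 'a::comm_monoid_add"
  shows "(\<Sum>k<s + t. if k < s then F k else G (k - s)) = (\<Sum>k<s. F k) + (\<Sum>k<t. G k)"
  by (induction t) (auto simp: add.assoc)

lemma sum_of_squares_add:
  assumes "sum_of_squares f" "sum_of_squares g"
  shows "sum_of_squares (f + g)"
proof -
  obtain s :: nat and q where "f = (\<Sum>l<s. (q l)\<^sup>2)"
    using assms(1) unfolding sum_of_squares_def by (elim exE)
  moreover obtain t :: nat and r where "g = (\<Sum>l<t. (r l)\<^sup>2)"
    using assms(2) unfolding sum_of_squares_def by (elim exE)
  ultimately have "f + g = (\<Sum>k<s + t. (if k < s then q k else r (k - s :: nat))\<^sup>2)"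
    using sum_lessThan_add_cases[of s "\<lambda>l. (q l)\<^sup>2" "\<lambda>l. (r l)\<^sup>2" t] by (simp add: if_distrib[of "\<lambda>x. x\<^sup>2"])
  then show ?thesis
    unfolding sum_of_squares_def by (intro exI)
qed

lemma sum_of_squares_sum: "(\<And>a. a \<in> A \<Longrightarrow> sum_of_squares (f a)) \<Longrightarrow> sum_of_squares (sum f A)"
  by (induction A rule: infinite_finite_induct) (auto intro: sum_of_squares_add sum_of_squares_0)

lemma eval_poly_sum_of_squares_nonneg: "sum_of_squares f \<Longrightarrow> 0 \<le> eval_poly f x"
  by (auto simp: sum_of_squares_def intro!: sum_nonneg)

text \<open>Expanding in powers of \<open>s\<close> collects the integrals into the moment matrix of
  the weight \<open>1 - s\<close> on the unit interval. It is positive semidefinite because its form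
  at a real vector \<open>v\<close> is the integral of a nonnegative function. The matrix does not
  depend on \<open>x\<close>, so one sum of squares serves all \<open>x\<close>.\<close>

lemma sum_of_squares_integral:
  fixes Q :: "'n::finite rpoly poly"
  shows "\<exists>S. sum_of_squares S \<and>
    (\<forall>x. ((\<lambda>s. (1 - s) * (eval_poly (poly Q (const_poly s)) x)\<^sup>2) has_integral eval_poly S x) {0..1})"
proof -
  define n where "n = Suc (degree Q)"
  define M :: "nat \<Rightarrow> nat \<Rightarrow> real" where "M a b = integral {0..1} (\<lambda>s. (1 - s) * s ^ a * s ^ b)" for a b
  have M: "((\<lambda>s. (1 - s) * s ^ a * s ^ b) has_integral M a b) {0..1}" for a b
    unfolding M_def
    by (intro integrable_integral integrable_continuous_interval continuous_intros)
  have form: "((\<lambda>s. (1 - s) * (\<Sum>a<n. v a * s ^ a)\<^sup>2) has_integral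
      (\<Sum>a<n. \<Sum>b<n. M a b * v a * v b)) {0..1}" for v
  proof -
    have "((\<lambda>s. \<Sum>a<n. \<Sum>b<n. (1 - s) * s ^ a * s ^ b * v a * v b) has_integral
      (\<Sum>a<n. \<Sum>b<n. M a b * v a * v b)) {0..1}"
      by (intro has_integral_sum has_integral_mult_left M) auto
    moreover have "(\<Sum>a<n. \<Sum>b<n. (1 - s) * s ^ a * s ^ b * v a * v b) = (1 - s) * (\<Sum>a<n. v a * s ^ a)\<^sup>2" for s
      by (simp add: power2_eq_square sum_product sum_distrib_left mult_ac)
    ultimately show ?thesis
      by simp
  qed
  define S where "S = (\<Sum>a<n. \<Sum>b<n. const_poly (M a b) * coeff Q a * coeff Q b)"
  have "sum_of_squares S"
    unfolding S_def
  proof (rule sum_of_squares_psd_form)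
    show "M a b = M b a" for a b
      by (simp add: M_def mult_ac)
    show "0 \<le> (\<Sum>a<n. \<Sum>b<n. M a b * v a * v b)" for v
      by (rule has_integral_nonneg[OF form]) auto
  qed
  moreover have "((\<lambda>s. (1 - s) * (eval_poly (poly Q (const_poly s)) x)\<^sup>2) has_integral eval_poly S x) {0..1}" for x
  proof -
    have "eval_poly (poly Q (const_poly s)) x = (\<Sum>a<n. eval_poly (coeff Q a) x * s ^ a)" for s
      by (simp add: poly_altdef n_def lessThan_Suc_atMost)
    then show ?thesis
      using form[of "\<lambda>a. eval_poly (coeff Q a) x"] by (simp add: S_def)
  qed
  ultimately show ?thesis
    by blast
qed

section \<open>Taylor expansion of SOS-convex polynomials\<close>

text \<open>The variable of \<open>P\<close> is the segment parameter \<open>s\<close>, its coefficients are polynomials in \<open>x\<close>.\<close>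

definition line_poly :: "(real \<Rightarrow> real ^ 'n \<Rightarrow> real) \<Rightarrow> bool" where
  "line_poly F \<longleftrightarrow> (\<exists>P :: 'n::finite rpoly poly. \<forall>s x. F s x = eval_poly (poly P (const_poly s)) x)"

lemma line_poly_eval: "line_poly (\<lambda>s. eval_poly f)"
  unfolding line_poly_def by (intro exI[of _ "[:f:]"]) simp

lemma line_poly_param: "line_poly (\<lambda>s x. s)"
  unfolding line_poly_def by (intro exI[of _ "[:0, 1:]"]) simp

lemma line_poly_add: "line_poly F \<Longrightarrow> line_poly G \<Longrightarrow> line_poly (\<lambda>s x. F s x + G s x)"
  unfolding line_poly_def by (metis poly_add eval_poly_add)

lemma line_poly_mult: "line_poly F \<Longrightarrow> line_poly G \<Longrightarrow> line_poly (\<lambda>s x. F s x * G s x)"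
  unfolding line_poly_def by (metis poly_mult eval_poly_mult)

lemma line_poly_const: "line_poly (\<lambda>s x. c)"
  unfolding line_poly_def by (intro exI[of _ "[:const_poly c:]"]) simp

lemma line_poly_coord: "line_poly (\<lambda>s x. x $ i)"
  using line_poly_eval[of "var_poly i"] by (simp add: fun_eq_iff line_poly_def)

lemma line_poly_diff: "line_poly F \<Longrightarrow> line_poly G \<Longrightarrow> line_poly (\<lambda>s x. F s x - G s x)"
  using line_poly_add[OF _ line_poly_mult[OF line_poly_const[of "-1"]], of F G] by simp

lemma line_poly_sum: "(\<And>a. a \<in> A \<Longrightarrow> line_poly (F a)) \<Longrightarrow> line_poly (\<lambda>s x. \<Sum>a\<in>A. F a s x)"
  by (induction A rule: infinite_finite_induct) (auto intro: line_poly_add line_poly_const)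

lemma line_poly_prod: "(\<And>a. a \<in> A \<Longrightarrow> line_poly (F a)) \<Longrightarrow> line_poly (\<lambda>s x. \<Prod>a\<in>A. F a s x)"
  by (induction A rule: infinite_finite_induct) (auto intro: line_poly_mult line_poly_const)

lemma line_poly_power: "line_poly F \<Longrightarrow> line_poly (\<lambda>s x. F s x ^ k)"
  by (induction k) (auto intro: line_poly_mult line_poly_const)

lemma line_poly_eval_segment: "line_poly (\<lambda>s x. eval_poly h (u + s *\<^sub>R (x - u)))"
  unfolding eval_poly_def
  by (auto intro!: line_poly_sum line_poly_prod line_poly_mult line_poly_const line_poly_power
      line_poly_add line_poly_diff line_poly_param line_poly_coord)

lemma has_vector_derivative_eval_poly_line:
  "((\<lambda>s. eval_poly f (u + s *\<^sub>R w)) has_vector_derivative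
    (\<Sum>i\<in>UNIV. eval_poly (partial_poly i f) (u + s *\<^sub>R w) * w $ i)) (at s within T)"
proof -
  have "((\<lambda>s. u + s *\<^sub>R w) has_derivative (\<lambda>h. h *\<^sub>R w)) (at s within T)"
    by (auto intro!: derivative_eq_intros)
  from has_derivative_compose[OF this has_derivative_eval_poly]
  show ?thesis
    by (simp add: has_vector_derivative_def sum_distrib_left mult_ac)
qed

text \<open>
  Taylor's formula with integral remainder along the segment from \<open>u\<close> to \<open>x\<close>: the integrand is
  \<open>1 - s\<close> times a sum of squares, and integrating out \<open>s\<close> leaves a positive semidefinite
  quadratic form in the coefficients of the powers of \<open>s\<close>.
\<close>

lemma sos_convex_taylor:
  fixes f :: "'n::finite rpoly"
  assumes "sos_convex f"
  shows "\<exists>S. sum_of_squares S \<and> (\<forall>x. eval_poly f x = eval_poly f u +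
    (\<Sum>i\<in>UNIV. eval_poly (partial_poly i f) u * (x $ i - u $ i)) + eval_poly S x)"
proof -
  obtain r :: nat and H where H: "\<And>i j. hessian_poly f i j = (\<Sum>k<r. H i k * H j k)"
    using assms unfolding sos_convex_def sos_matrix_def by metis
  \<comment> \<open>The \<open>k\<close>-th entry of \<open>H\<^sup>T (x - u)\<close> with
    \<open>H\<close> taken at a point of the segment; the squares of these entries add up to the
    second derivative of \<open>f\<close> along the segment.\<close>
  define q where "q k s x = (\<Sum>i\<in>UNIV. eval_poly (H i k) (u + s *\<^sub>R (x - u)) * (x $ i - u $ i))" for k s x
  have "\<exists>S. sum_of_squares S \<and> (\<forall>x. ((\<lambda>s. (1 - s) * (q k s x)\<^sup>2) has_integral eval_poly S x) {0..1})" for k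
  proof -
    have "line_poly (q k)"
      unfolding q_def
      by (intro line_poly_sum line_poly_mult line_poly_eval_segment line_poly_diff line_poly_coord line_poly_const)
    then obtain Q :: "'n rpoly poly" where "\<And>s x. q k s x = eval_poly (poly Q (const_poly s)) x"
      unfolding line_poly_def by blast
    then show ?thesis
      using sum_of_squares_integral[of Q] by simp
  qed
  then obtain S where S: "\<And>k. sum_of_squares (S k)"
    "\<And>k x. ((\<lambda>s. (1 - s) * (q k s x)\<^sup>2) has_integral eval_poly (S k) x) {0..1}"
    by metis
  have "eval_poly f x = eval_poly f u +
    (\<Sum>i\<in>UNIV. eval_poly (partial_poly i f) u * (x $ i - u $ i)) + eval_poly (\<Sum>k<r. S k) x" for x
  proof -
    define w where "w = x - u"
    \<comment> \<open>The derivatives of orders 0, 1 and 2 along the segment, as the indexed family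
      that \<open>Taylor_has_integral\<close> takes; order 2 is entered directly as a sum of
      squares.\<close>
    define D :: "nat \<Rightarrow> real \<Rightarrow> real" where "D m s =
      (if m = 0 then eval_poly f (u + s *\<^sub>R w)
       else if m = 1 then \<Sum>i\<in>UNIV. eval_poly (partial_poly i f) (u + s *\<^sub>R w) * w $ i
       else \<Sum>k<r. (q k s x)\<^sup>2)" for m s
    have D1: "D 1 = (\<lambda>s. \<Sum>i\<in>UNIV. eval_poly (partial_poly i f) (u + s *\<^sub>R w) * w $ i)"
      by (simp add: D_def fun_eq_iff)
    \<comment> \<open>The Hessian factorization enters here: \<open>w\<^sup>T H H\<^sup>T w\<close>
      is the squared length of \<open>H\<^sup>T w\<close>.\<close>
    have D2: "D 2 s = (\<Sum>i\<in>UNIV. (\<Sum>j\<in>UNIV. eval_poly (partial_poly j (partial_poly i f)) (u + s *\<^sub>R w) * w $ j) * w $ i)" for s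
    proof -
      have "(\<Sum>i\<in>UNIV. (\<Sum>j\<in>UNIV. eval_poly (partial_poly j (partial_poly i f)) (u + s *\<^sub>R w) * w $ j) * w $ i)
        = (\<Sum>i\<in>UNIV. \<Sum>j\<in>UNIV. \<Sum>k<r. eval_poly (H i k) (u + s *\<^sub>R w) * w $ i * (eval_poly (H j k) (u + s *\<^sub>R w) * w $ j))"
        unfolding hessian_poly_def[symmetric]
        by (simp add: H sum_distrib_right sum_distrib_left mult_ac)
      also have "\<dots> = (\<Sum>i\<in>UNIV. \<Sum>k<r. \<Sum>j\<in>UNIV. eval_poly (H i k) (u + s *\<^sub>R w) * w $ i * (eval_poly (H j k) (u + s *\<^sub>R w) * w $ j))"
        by (intro sum.cong refl sum.swap)
      also have "\<dots> = (\<Sum>k<r. \<Sum>i\<in>UNIV. \<Sum>j\<in>UNIV. eval_poly (H i k) (u + s *\<^sub>R w) * w $ i * (eval_poly (H j k) (u + s *\<^sub>R w) * w $ j))"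
        by (rule sum.swap)
      also have "\<dots> = D 2 s"
        by (simp add: D_def q_def power2_eq_square sum_product w_def)
      finally show ?thesis ..
    qed
    have deriv: "(D m has_vector_derivative D (Suc m) s) (at s within {0..1})" if "m < 2" for m s
    proof (cases "m = 0")
      case True
      then show ?thesis
        using has_vector_derivative_eval_poly_line[of f u w s "{0..1}"] by (simp add: D_def[abs_def])
    next
      case False
      with that have m: "m = 1"
        by simp
      have "(D 1 has_vector_derivative D 2 s) (at s within {0..1})"
        unfolding D1 D2
        by (intro has_vector_derivative_sum has_vector_derivative_mult_left
            has_vector_derivative_eval_poly_line)
      then show ?thesis
        by (simp only: m Suc_1)
    qed
    have "((\<lambda>s. ((1 - s) ^ (2 - 1) / fact (2 - 1)) *\<^sub>R D 2 s) has_integral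
        D 0 1 - (\<Sum>i<2. ((1 - 0) ^ i / fact i) *\<^sub>R D i 0)) {0..1}"
      by (rule Taylor_has_integral) (use deriv in auto)
    then have "((\<lambda>s. (1 - s) * D 2 s) has_integral D 0 1 - (D 0 0 + D 1 0)) {0..1}"
      by (simp add: numeral_2_eq_2)
    moreover have "((\<lambda>s. (1 - s) * D 2 s) has_integral (\<Sum>k<r. eval_poly (S k) x)) {0..1}"
    proof -
      have "((\<lambda>s. \<Sum>k<r. (1 - s) * (q k s x)\<^sup>2) has_integral (\<Sum>k<r. eval_poly (S k) x)) {0..1}"
        by (intro has_integral_sum S) auto
      then show ?thesis
        by (simp add: D_def sum_distrib_left)
    qed
    ultimately have "D 0 1 - (D 0 0 + D 1 0) = (\<Sum>k<r. eval_poly (S k) x)"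
      by (rule has_integral_unique)
    then show ?thesis
      by (simp add: D_def w_def algebra_simps)
  qed
  moreover have "sum_of_squares (\<Sum>k<r. S k)"
    by (intro sum_of_squares_sum S)
  ultimately show ?thesis
    by blast
qed

section \<open>Minimizers of SOS-convex polynomials\<close>

lemma sos_matrix_add:
  assumes "sos_matrix M" "sos_matrix N"
  shows "sos_matrix (\<lambda>i j. M i j + N i j)"
proof -
  obtain s :: nat and H where "\<And>i j. M i j = (\<Sum>k<s. H i k * H j k)"
    using assms(1) unfolding sos_matrix_def by blast
  moreover obtain t :: nat and K where "\<And>i j. N i j = (\<Sum>k<t. K i k * K j k)"
    using assms(2) unfolding sos_matrix_def by blast
  moreover have "(if k < s then H i k else K i (k - s)) * (if k < s then H j k else K j (k - s)) =
      (if k < s then H i k * H j k else K i (k - s) * K j (k - s))" for i j k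
    by simp
  ultimately have "M i j + N i j = (\<Sum>k<s + t. (if k < s then H i k else K i (k - s)) *
      (if k < s then H j k else K j (k - s)))" for i j
    using sum_lessThan_add_cases[of s "\<lambda>k. H i k * H j k" "\<lambda>k. K i k * K j k" t] by (simp only:)
  then show ?thesis
    \<comment> \<open>The columns of the two factors are placed side by side.\<close>
    unfolding sos_matrix_def
    by (intro exI[of _ "s + t"] exI[of _ "\<lambda>i k. if k < s then H i k else K i (k - s)"]) simp
qed

lemma sos_convex_add: "sos_convex f \<Longrightarrow> sos_convex g \<Longrightarrow> sos_convex (f + g)"
  using sos_matrix_add[of "hessian_poly f" "hessian_poly g"]
  by (simp add: sos_convex_def hessian_poly_def[abs_def] partial_poly_add)

lemma sos_convex_const: "sos_convex (const_poly c)"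
  unfolding sos_convex_def sos_matrix_def hessian_poly_def by (intro exI[of _ 0]) simp

lemma const_poly_mult: "const_poly (a * b) = const_poly a * const_poly b"
  by (simp add: const_poly_def mult_single)

lemma sos_convex_const_mult:
  assumes "sos_convex f" "0 \<le> c"
  shows "sos_convex (const_poly c * f)"
proof -
  obtain s :: nat and H where H: "\<And>i j. hessian_poly f i j = (\<Sum>k<s. H i k * H j k)"
    using assms(1) unfolding sos_convex_def sos_matrix_def by blast
  \<comment> \<open>Splitting \<open>c\<close> as \<open>sqrt c * sqrt c\<close> lets each of the
    two copies of \<open>H\<close> absorb one root.\<close>
  have "hessian_poly (const_poly c * f) i j = const_poly (sqrt c * sqrt c) * hessian_poly f i j" for i j
    using assms(2) by (simp add: hessian_poly_def partial_poly_const_mult)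
  then have "hessian_poly (const_poly c * f) i j =
      (\<Sum>k<s. (const_poly (sqrt c) * H i k) * (const_poly (sqrt c) * H j k))" for i j
    unfolding const_poly_mult H by (simp add: sum_distrib_left mult_ac)
  then show ?thesis
    unfolding sos_convex_def sos_matrix_def
    by (intro exI[of _ s] exI[of _ "\<lambda>i k. const_poly (sqrt c) * H i k"]) simp
qed

lemma sos_convex_sum: "(\<And>a. a \<in> A \<Longrightarrow> sos_convex (f a)) \<Longrightarrow> sos_convex (sum f A)"
  using sos_convex_const[of 0]
  by (induction A rule: infinite_finite_induct) (auto intro: sos_convex_add simp: const_poly_def)

lemma continuous_on_eval_poly: "continuous_on A (eval_poly f)"
  by (meson continuous_at_imp_continuous_on has_derivative_continuous has_derivative_eval_poly)

lemma sos_convex_above_tangent: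
  assumes "sos_convex f"
  shows "eval_poly f u + (\<Sum>i\<in>UNIV. eval_poly (partial_poly i f) u * (x $ i - u $ i)) \<le> eval_poly f x"
proof -
  obtain S where "sum_of_squares S" and S: "\<And>x. eval_poly f x = eval_poly f u +
    (\<Sum>i\<in>UNIV. eval_poly (partial_poly i f) u * (x $ i - u $ i)) + eval_poly S x"
    using sos_convex_taylor[OF assms, of u] by blast
  then show ?thesis
    using S[of x] eval_poly_sum_of_squares_nonneg[of S x] by linarith
qed

text \<open>The tangent inequalities at the intermediate point \<open>z\<close> are averaged, and
  the linear terms cancel in the average.\<close>

lemma convex_on_eval_poly:
  assumes "sos_convex f"
  shows "convex_on UNIV (eval_poly f)"
proof (rule convex_onI)
  fix t :: real and x y :: "real ^ 'a"
  assume t: "0 < t" "t < 1"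
  define z where "z = (1 - t) *\<^sub>R x + t *\<^sub>R y"
  define G where "G v = (\<Sum>i\<in>UNIV. eval_poly (partial_poly i f) z * (v $ i - z $ i))" for v
  have "(1 - t) * G x + t * G y = (\<Sum>i\<in>UNIV. eval_poly (partial_poly i f) z * ((1 - t) * (x $ i - z $ i) + t * (y $ i - z $ i)))"
    unfolding G_def sum_distrib_left sum.distrib[symmetric]
    by (intro sum.cong refl) (simp add: algebra_simps)
  also have "\<dots> = 0"
    by (intro sum.neutral) (simp add: z_def algebra_simps)
  finally have G: "(1 - t) * G x + t * G y = 0" .
  have "eval_poly f z = (1 - t) * (eval_poly f z + G x) + t * (eval_poly f z + G y)"
    using G by (simp add: algebra_simps)
  also have "\<dots> \<le> (1 - t) * eval_poly f x + t * eval_poly f y"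
    using t sos_convex_above_tangent[OF assms] unfolding G_def
    by (intro add_mono mult_left_mono) auto
  finally show "eval_poly f ((1 - t) *\<^sub>R x + t *\<^sub>R y) \<le> (1 - t) * eval_poly f x + t * eval_poly f y"
    by (simp add: z_def)
qed simp

section \<open>Existence of minimizers\<close>

lemma eval_poly_ray_polynomial:
  fixes f :: "'n::finite rpoly"
  obtains P :: "real poly" where "\<And>t. eval_poly f (x + t *\<^sub>R v) = poly P t"
proof -
  have "line_poly (\<lambda>s y. eval_poly f (x + s *\<^sub>R (y - x)))"
    by (rule line_poly_eval_segment)
  then obtain Q :: "'n rpoly poly" where
    Q: "\<And>s y. eval_poly f (x + s *\<^sub>R (y - x)) = eval_poly (poly Q (const_poly s)) y"
    unfolding line_poly_def by blast
  have "eval_poly f (x + t *\<^sub>R v) = poly (\<Sum>a\<le>degree Q. monom (eval_poly (coeff Q a) (x + v)) a) t" for t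
    using Q[of t "x + v"] by (simp add: poly_altdef[of Q] poly_sum poly_monom)
  then show ?thesis
    using that by blast
qed

text \<open>A nonconstant polynomial is unbounded along the nonnegative half-line already, so a
  bound there settles negative \<open>t\<close> as well.\<close>

lemma poly_bounded_at_top_const:
  fixes P :: "real poly"
  assumes "\<And>t. 0 \<le> t \<Longrightarrow> \<bar>poly P t\<bar> \<le> B"
  shows "poly P t = poly P 0"
proof -
  have "degree P = 0"
  proof (rule ccontr)
    assume "degree P \<noteq> 0"
    then have "\<exists>k. k \<noteq> 0 \<and> k \<le> degree P \<and> coeff P k \<noteq> 0"
      by (intro exI[of _ "degree P"]) auto
    from polyfun_extremal[OF this, of "B + 1"]
    have "eventually (\<lambda>z. B + 1 \<le> \<bar>poly P z\<bar>) at_infinity"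
      by (simp add: poly_altdef)
    then obtain b where "\<And>z. b \<le> \<bar>z\<bar> \<Longrightarrow> B + 1 \<le> \<bar>poly P z\<bar>"
      by (auto simp: eventually_at_infinity)
    from this[of "\<bar>b\<bar>"] assms[of "\<bar>b\<bar>"] show False
      by linarith
  qed
  then obtain a where "P = [:a:]"
    by (rule degree_eq_zeroE)
  then show ?thesis
    by simp
qed

text \<open>
  A direction in which a convex polynomial stays bounded is a direction of constancy: convexity
  spreads the bound from one ray to all parallel rays, and a bounded univariate polynomial is constant.
\<close>

lemma constant_along_bounded_ray:
  assumes conv: "convex_on UNIV (eval_poly f)"
    and low: "\<And>x. c \<le> eval_poly f x"
    and up: "\<And>t. 0 \<le> t \<Longrightarrow> eval_poly f (t *\<^sub>R v) \<le> B"
  shows "eval_poly f (x + t *\<^sub>R v) = eval_poly f x"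
proof -
  have ray: "eval_poly f (x + t *\<^sub>R v) \<le> eval_poly f x" if "0 \<le> t" for x t
  proof -
    \<comment> \<open>The point lies between \<open>x\<close> and the far point
      \<open>(t / e) *\<^sub>R v\<close> of the bounded ray, which has weight \<open>e\<close>;
      letting \<open>e\<close> tend to 0 removes the bound \<open>B\<close>.\<close>
    have "eval_poly f ((1 - e) *\<^sub>R x + t *\<^sub>R v) \<le> (1 - e) * eval_poly f x + e * B" if e: "0 < e" "e < 1" for e
    proof -
      have "eval_poly f ((1 - e) *\<^sub>R x + e *\<^sub>R ((t / e) *\<^sub>R v)) \<le> (1 - e) * eval_poly f x + e * eval_poly f ((t / e) *\<^sub>R v)"
        using conv e by (intro convex_onD) auto
      also have "\<dots> \<le> (1 - e) * eval_poly f x + e * B"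
        using up[of "t / e"] e \<open>0 \<le> t\<close> by simp
      finally show ?thesis
        using e by simp
    qed
    then have ev: "eventually (\<lambda>e. eval_poly f ((1 - e) *\<^sub>R x + t *\<^sub>R v) \<le> (1 - e) * eval_poly f x + e * B) (at_right 0)"
      unfolding eventually_at_right_field by (intro exI[of _ 1]) auto
    have "isCont (eval_poly f) y" for y
      by (meson has_derivative_continuous has_derivative_eval_poly)
    then have 1: "((\<lambda>e. eval_poly f ((1 - e) *\<^sub>R x + t *\<^sub>R v)) \<longlongrightarrow> eval_poly f ((1 - 0) *\<^sub>R x + t *\<^sub>R v)) (at_right 0)"
      by (intro isCont_tendsto_compose[where g = "eval_poly f"] tendsto_intros) auto
    have 2: "((\<lambda>e. (1 - e) * eval_poly f x + e * B) \<longlongrightarrow> (1 - 0) * eval_poly f x + 0 * B) (at_right 0)"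
      by (intro tendsto_intros)
    from tendsto_le[OF _ 2 1 ev] show ?thesis
      by simp
  qed
  obtain P where P: "\<And>t. eval_poly f (x + t *\<^sub>R v) = poly P t"
    using eval_poly_ray_polynomial by blast
  have "\<bar>poly P t\<bar> \<le> \<bar>c\<bar> + \<bar>eval_poly f x\<bar>" if "0 \<le> t" for t
    using ray[OF that, of x] low[of "x + t *\<^sub>R v"] P[of t] by linarith
  from poly_bounded_at_top_const[OF this, of t] show ?thesis
    using P[of t] P[of 0] by simp
qed

text \<open>
  Restricted to the orthogonal complement of the constancy space, the sublevel sets contain no ray
  and are therefore compact.
\<close>

lemma convex_poly_attains_min:
  fixes f :: "'n::finite rpoly"
  assumes conv: "convex_on UNIV (eval_poly f)"
    and low: "\<And>x. c \<le> eval_poly f x"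
  shows "\<exists>u. \<forall>x. eval_poly f u \<le> eval_poly f x"
proof -
  \<comment> \<open>Constancy is required through every base point \<open>x\<close>, so that for a
    sum of two directions one can move along the first and then along the second.\<close>
  define V where "V = {v. \<forall>x t. eval_poly f (x + t *\<^sub>R v) = eval_poly f x}"
  have "subspace V"
    unfolding subspace_def
  proof (intro conjI ballI allI)
    fix v w assume "v \<in> V" "w \<in> V"
    then have "eval_poly f (x + t *\<^sub>R v + t *\<^sub>R w) = eval_poly f x" for x t
      by (simp add: V_def)
    then show "v + w \<in> V"
      by (simp add: V_def scaleR_add_right add.assoc)
  qed (auto simp: V_def)
  define W where "W = {w. \<forall>v\<in>V. orthogonal v w}"
  have W: "subspace W"
    unfolding W_def by (simp add: subspace_orthogonal_to_vectors)
  define S where "S = {x \<in> W. eval_poly f x \<le> eval_poly f 0}"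
  have "0 \<in> S"
    using W by (simp add: S_def subspace_0)
  have closed: "closed S"
  proof -
    have "closed W"
      using W by (rule closed_subspace)
    moreover have "closed {x. eval_poly f x \<le> eval_poly f 0}"
      by (intro closed_Collect_le continuous_on_eval_poly continuous_on_const)
    ultimately show ?thesis
      unfolding S_def by (simp add: closed_Int Collect_conj_eq)
  qed
  have convex: "convex S"
  proof -
    have "convex {x. eval_poly f x \<le> eval_poly f 0}"
    proof (rule convexI)
      fix x y :: "real ^ 'n" and a b :: real
      assume xy: "x \<in> {x. eval_poly f x \<le> eval_poly f 0}" "y \<in> {x. eval_poly f x \<le> eval_poly f 0}"
        and ab: "0 \<le> a" "0 \<le> b" "a + b = 1"
      have "eval_poly f (a *\<^sub>R x + b *\<^sub>R y) \<le> a * eval_poly f x + b * eval_poly f y"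
        using conv ab unfolding convex_on_def by blast
      also have "\<dots> \<le> eval_poly f 0"
        using xy ab by (intro convex_bound_le) auto
      finally show "a *\<^sub>R x + b *\<^sub>R y \<in> {x. eval_poly f x \<le> eval_poly f 0}"
        by simp
    qed
    then show ?thesis
      using W unfolding S_def by (simp add: Collect_conj_eq convex_Int subspace_imp_convex)
  qed
  have "bounded S"
  proof (rule ccontr)
    assume "\<not> bounded S"
    then have "\<exists>x\<in>S. real k < norm x" for k :: nat
      unfolding bounded_iff by (meson not_le)
    then obtain X where X: "\<And>k. X k \<in> S" "\<And>k. real k < norm (X k)"
      by metis
    then have pos: "0 < norm (X k)" for k
      by (meson le_less_trans of_nat_0_le_iff)
    have sphere: "\<forall>k. X k /\<^sub>R norm (X k) \<in> sphere 0 1"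
    proof
      fix k
      show "X k /\<^sub>R norm (X k) \<in> sphere 0 1"
        using pos[of k] by simp
    qed
    then obtain v r where r: "strict_mono r" "((\<lambda>k. X k /\<^sub>R norm (X k)) \<circ> r) \<longlonglongrightarrow> v" and v: "v \<in> sphere 0 1"
      using seq_compactE[OF compact_imp_seq_compact[OF compact_sphere] sphere] by blast
    have ray: "t *\<^sub>R v \<in> S" if "0 \<le> t" for t
    proof (rule Lim_in_closed_set[OF closed])
      show "(\<lambda>k. t *\<^sub>R ((\<lambda>k. X k /\<^sub>R norm (X k)) \<circ> r) k) \<longlonglongrightarrow> t *\<^sub>R v"
        by (intro tendsto_intros r)
      \<comment> \<open>From this index on the norm of \<open>X (r k)\<close> exceeds
        \<open>t\<close>, so the point lies on the segment from 0 to \<open>X (r k)\<close>, which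
        convexity keeps inside \<open>S\<close>.\<close>
      have "t *\<^sub>R ((\<lambda>k. X k /\<^sub>R norm (X k)) \<circ> r) k \<in> S" if "nat \<lceil>t\<rceil> \<le> k" for k
      proof -
        have "t \<le> real k"
          using that by linarith
        also have "\<dots> \<le> real (r k)"
          using r(1) by (simp add: seq_suble)
        also have "\<dots> < norm (X (r k))"
          by (rule X)
        finally have "t < norm (X (r k))" .
        then have "(1 - t / norm (X (r k))) *\<^sub>R 0 + (t / norm (X (r k))) *\<^sub>R X (r k) \<in> S"
          using \<open>0 \<le> t\<close> pos[of "r k"] by (intro convexD_alt[OF convex] \<open>0 \<in> S\<close> X) auto
        then show ?thesis
          by (simp add: divide_inverse)
      qed
      then show "eventually (\<lambda>k. t *\<^sub>R ((\<lambda>k. X k /\<^sub>R norm (X k)) \<circ> r) k \<in> S) sequentially"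
        unfolding eventually_sequentially by blast
    qed simp
    have "eval_poly f (x + t *\<^sub>R v) = eval_poly f x" for x t
      by (rule constant_along_bounded_ray[OF conv low]) (use ray in \<open>auto simp: S_def\<close>)
    then have "v \<in> V"
      by (simp add: V_def)
    moreover have "v \<in> W"
      using ray[of 1] by (simp add: S_def)
    ultimately have "v = 0"
      unfolding W_def using orthogonal_self by blast
    with v show False
      by simp
  qed
  with closed have "compact S"
    by (simp add: compact_eq_bounded_closed)
  then obtain u where u: "u \<in> S" "\<And>y. y \<in> S \<Longrightarrow> eval_poly f u \<le> eval_poly f y"
    using continuous_attains_inf[of S "eval_poly f"] \<open>0 \<in> S\<close> continuous_on_eval_poly by blast
  have "eval_poly f u \<le> eval_poly f x" for x
  proof -
    obtain y z where yz: "y \<in> V" "\<And>w. w \<in> V \<Longrightarrow> orthogonal z w" "x = y + z"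
      using orthogonal_subspace_decomp_exists[of V x] \<open>subspace V\<close>
      by (metis span_eq_iff)
    then have "z \<in> W"
      by (simp add: W_def orthogonal_commute)
    have "eval_poly f (z + 1 *\<^sub>R y) = eval_poly f z"
      using yz(1) unfolding V_def by blast
    then have "eval_poly f x = eval_poly f z"
      by (simp add: yz(3) add.commute)
    \<comment> \<open>A \<open>z\<close> outside \<open>S\<close> has a value above the one at 0,
      which is at least the minimum over \<open>S\<close>.\<close>
    moreover have "eval_poly f u \<le> eval_poly f z"
      using u \<open>z \<in> W\<close> \<open>0 \<in> S\<close> by (cases "z \<in> S") (auto simp: S_def intro: order_trans[of _ "eval_poly f 0"])
    ultimately show ?thesis
      by simp
  qed
  then show ?thesis
    by blast
qed

lemma eval_poly_partial_eq_0_at_min: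
  assumes "\<And>x. eval_poly f u \<le> eval_poly f x"
  shows "eval_poly (partial_poly i f) u = 0"
proof -
  have "(\<lambda>h. \<Sum>i\<in>UNIV. eval_poly (partial_poly i f) u * h $ i) = (\<lambda>h. 0)"
    by (rule has_derivative_local_min[OF has_derivative_eval_poly]) (simp add: assms)
  from fun_cong[OF this, of "axis i 1"] show ?thesis
    by (simp add: axis_def if_distrib cong: if_cong)
qed

lemma sos_convex_nonneg_imp_sum_of_squares:
  assumes "sos_convex f" "\<And>x. 0 \<le> eval_poly f x"
  shows "sum_of_squares f"
proof -
  obtain u where u: "\<And>x. eval_poly f u \<le> eval_poly f x"
    using convex_poly_attains_min[OF convex_on_eval_poly[OF assms(1)] assms(2)] by blast
  obtain S where S: "sum_of_squares S" "\<And>x. eval_poly f x = eval_poly f u +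
    (\<Sum>i\<in>UNIV. eval_poly (partial_poly i f) u * (x $ i - u $ i)) + eval_poly S x"
    using sos_convex_taylor[OF assms(1), of u] by blast
  have "f = (const_poly (sqrt (eval_poly f u)))\<^sup>2 + S"
  proof (rule eval_poly_inject)
    fix x
    have "eval_poly f x = eval_poly f u + eval_poly S x"
      using S(2)[of x] by (simp add: eval_poly_partial_eq_0_at_min[OF u])
    then show "eval_poly f x = eval_poly ((const_poly (sqrt (eval_poly f u)))\<^sup>2 + S) x"
      using assms(2)[of u] by simp
  qed
  then show ?thesis
    using sum_of_squares_add[OF sum_of_squares_power2 S(1)] by metis
qed

section \<open>Lagrange duality\<close>

lemma poly_degree_le_iff: "poly_degree f \<le> d \<longleftrightarrow> (\<forall>a\<in>Poly_Mapping.keys f. exp_degree a \<le> d)"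
  unfolding poly_degree_def by auto

lemma poly_degree_add_le: "poly_degree f \<le> d \<Longrightarrow> poly_degree g \<le> d \<Longrightarrow> poly_degree (f + g) \<le> d"
  unfolding poly_degree_le_iff using Poly_Mapping.keys_add[of f g] by blast

lemma poly_degree_const: "poly_degree (const_poly c) \<le> d"
  unfolding poly_degree_le_iff const_poly_def by (auto simp: exp_degree_def)

lemma poly_degree_const_mult_le: "poly_degree f \<le> d \<Longrightarrow> poly_degree (const_poly c * f) \<le> d"
  unfolding poly_degree_le_iff by (auto simp: in_keys_iff lookup_const_poly_mult)

lemma poly_degree_sum_le: "(\<And>a. a \<in> A \<Longrightarrow> poly_degree (f a) \<le> d) \<Longrightarrow> poly_degree (sum f A) \<le> d"
  using poly_degree_const[of 0 d]
  by (induction A rule: infinite_finite_induct) (auto intro: poly_degree_add_le simp: const_poly_def)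

lemma const_poly_uminus: "const_poly (- c) = - const_poly c"
  by (simp add: const_poly_def single_uminus)

lemma sum_mult_add_axis:
  fixes w y :: "real ^ 'k::finite"
  shows "(\<Sum>j\<in>UNIV. w $ j * (y + t *\<^sub>R axis k 1) $ j) = (\<Sum>j\<in>UNIV. w $ j * y $ j) + t * w $ k"
proof -
  have "w \<bullet> (y + t *\<^sub>R axis k 1) = w \<bullet> y + t * w $ k"
    by (simp add: inner_add_right inner_axis)
  then show ?thesis
    by (simp only: inner_vec_def inner_real_def)
qed

text \<open>
  Lagrange multipliers come from a hyperplane separating \<open>0\<close> from the set of pairs \<open>(y, z)\<close> that
  dominate \<open>(p x - v, g x)\<close> for some \<open>x\<close>; the Slater point forces the weight of the objective
  part to be positive, so it can be normalized into the simplex.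
\<close>

lemma convex_minimax_multipliers:
  fixes p :: "'r::finite \<Rightarrow> 'a::real_vector \<Rightarrow> real" and g :: "'m::finite \<Rightarrow> 'a \<Rightarrow> real"
  assumes p: "\<And>j. convex_on UNIV (p j)" and g: "\<And>i. convex_on UNIV (g i)"
    and slater: "\<And>i. g i x0 < 0"
    and v: "\<And>x. (\<And>i. g i x \<le> 0) \<Longrightarrow> \<exists>j. v \<le> p j x"
  shows "\<exists>\<delta>\<in>unit_simplex. \<exists>lam\<in>nonneg_orthant.
    \<forall>x. v \<le> (\<Sum>j\<in>UNIV. \<delta> $ j * p j x) + (\<Sum>i\<in>UNIV. lam $ i * g i x)"
proof -
  \<comment> \<open>Strictness in the first component makes \<open>0 \<in> A\<close> say that some
    feasible \<open>x\<close> has \<open>p j x < v\<close> for all \<open>j\<close>, which the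
    assumption on \<open>v\<close> rules out.\<close>
  define A :: "((real ^ 'r) \<times> (real ^ 'm)) set" where
    "A = {(y, z). \<exists>x. (\<forall>j. p j x - v < y $ j) \<and> (\<forall>i. g i x \<le> z $ i)}"
  have "convex A"
  proof (rule convexI)
    fix a b and s t :: real
    assume ab: "a \<in> A" "b \<in> A" and st: "0 \<le> s" "0 \<le> t" "s + t = 1"
    obtain y z x where a: "a = (y, z)" "\<And>j. p j x - v < y $ j" "\<And>i. g i x \<le> z $ i"
      using ab(1) unfolding A_def by blast
    obtain y' z' x' where b: "b = (y', z')" "\<And>j. p j x' - v < y' $ j" "\<And>i. g i x' \<le> z' $ i"
      using ab(2) unfolding A_def by blast
    have "p j (s *\<^sub>R x + t *\<^sub>R x') - v < s * y $ j + t * y' $ j" for j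
    proof -
      have "p j (s *\<^sub>R x + t *\<^sub>R x') \<le> s * p j x + t * p j x'"
        using p[of j] st unfolding convex_on_def by blast
      moreover have "s * (p j x - v) + t * (p j x' - v) < s * y $ j + t * y' $ j"
      \<comment> \<open>Strictness must come from a summand with positive weight, and for
        \<open>s = 0\<close> only the second one has it.\<close>
      proof (cases "s = 0")
        case True
        then show ?thesis
          using st b(2)[of j] by simp
      next
        case False
        then show ?thesis
          using st a(2)[of j] b(2)[of j] by (intro add_less_le_mono mult_left_mono) auto
      qed
      moreover have "s * v + t * v = v"
        using st(3) by (metis distrib_right mult_1)
      ultimately show ?thesis
        by (simp add: right_diff_distrib)
    qed
    moreover have "g i (s *\<^sub>R x + t *\<^sub>R x') \<le> s * z $ i + t * z' $ i" for i
    proof -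
      have "g i (s *\<^sub>R x + t *\<^sub>R x') \<le> s * g i x + t * g i x'"
        using g[of i] st unfolding convex_on_def by blast
      also have "\<dots> \<le> s * z $ i + t * z' $ i"
        using st a(3)[of i] b(3)[of i] by (intro add_mono mult_left_mono)
      finally show ?thesis .
    qed
    ultimately show "s *\<^sub>R a + t *\<^sub>R b \<in> A"
      unfolding A_def a(1) b(1) by auto
  qed
  moreover have "0 \<notin> A"
  proof
    assume "0 \<in> A"
    then obtain x where "\<And>j. p j x < v" "\<And>i. g i x \<le> 0"
      unfolding A_def by (auto simp: zero_prod_def)
    with v[of x] show False
      by (meson not_le)
  qed
  ultimately obtain c where "c \<noteq> 0" and c: "\<forall>q\<in>A. 0 \<le> inner c q"
    using separating_hyperplane_set_0 by blast
  obtain \<delta> lam where c_eq: "c = (\<delta>, lam)"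
    by (cases c)
  have sep: "0 \<le> (\<Sum>j\<in>UNIV. \<delta> $ j * y $ j) + (\<Sum>i\<in>UNIV. lam $ i * z $ i)"
    if "\<And>j. p j x - v < y $ j" "\<And>i. g i x \<le> z $ i" for x y z
  proof -
    have "(y, z) \<in> A"
      unfolding A_def using that by blast
    with c show ?thesis
      by (force simp: c_eq inner_vec_def)
  qed
  \<comment> \<open>The pair \<open>(Y, Z)\<close> lies in \<open>A\<close>, the added 1 giving the
    strict inequality. As \<open>A\<close> is upward closed, the coordinate rays from this pair stay
    in \<open>A\<close> and force every weight to be nonnegative.\<close>
  define Y :: "real ^ 'r" where "Y = (\<chi> j. p j x0 - v + 1)"
  define Z :: "real ^ 'm" where "Z = (\<chi> i. g i x0)"
  have nonneg_of_ray: "0 \<le> b" if "\<And>t. 0 \<le> t \<Longrightarrow> 0 \<le> a + t * b" for a b :: real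
  proof (rule ccontr)
    assume "\<not> 0 \<le> b"
    \<comment> \<open>At this value of \<open>t\<close> the expression \<open>a + t * b\<close>
      equals \<open>a - \<bar>a\<bar> - 1\<close>, which is negative.\<close>
    then have "0 \<le> (\<bar>a\<bar> + 1) / - b" "(\<bar>a\<bar> + 1) / - b * b = - (\<bar>a\<bar> + 1)"
      by (simp_all add: divide_nonneg_neg)
    with that[of "(\<bar>a\<bar> + 1) / - b"] show False
      by linarith
  qed
  have \<delta>0: "0 \<le> \<delta> $ k" for k
  proof (rule nonneg_of_ray)
    fix t :: real assume "0 \<le> t"
    then have "0 \<le> (\<Sum>j\<in>UNIV. \<delta> $ j * (Y + t *\<^sub>R axis k 1) $ j) + (\<Sum>i\<in>UNIV. lam $ i * Z $ i)"
      by (intro sep[of x0]) (auto simp: Y_def Z_def axis_def)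
    moreover have "(\<Sum>j\<in>UNIV. \<delta> $ j * (Y + t *\<^sub>R axis k 1) $ j) = (\<Sum>j\<in>UNIV. \<delta> $ j * Y $ j) + t * \<delta> $ k"
      by (rule sum_mult_add_axis)
    ultimately show "0 \<le> ((\<Sum>j\<in>UNIV. \<delta> $ j * Y $ j) + (\<Sum>i\<in>UNIV. lam $ i * Z $ i)) + t * \<delta> $ k"
      by simp
  qed
  have lam0: "0 \<le> lam $ k" for k
  proof (rule nonneg_of_ray)
    fix t :: real assume "0 \<le> t"
    then have "0 \<le> (\<Sum>j\<in>UNIV. \<delta> $ j * Y $ j) + (\<Sum>i\<in>UNIV. lam $ i * (Z + t *\<^sub>R axis k 1) $ i)"
      by (intro sep[of x0]) (auto simp: Y_def Z_def axis_def)
    moreover have "(\<Sum>i\<in>UNIV. lam $ i * (Z + t *\<^sub>R axis k 1) $ i) = (\<Sum>i\<in>UNIV. lam $ i * Z $ i) + t * lam $ k"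
      by (rule sum_mult_add_axis)
    ultimately show "0 \<le> ((\<Sum>j\<in>UNIV. \<delta> $ j * Y $ j) + (\<Sum>i\<in>UNIV. lam $ i * Z $ i)) + t * lam $ k"
      by simp
  qed
  define \<sigma> where "\<sigma> = (\<Sum>j\<in>UNIV. \<delta> $ j)"
  have lagrange: "0 \<le> (\<Sum>j\<in>UNIV. \<delta> $ j * (p j x - v)) + (\<Sum>i\<in>UNIV. lam $ i * g i x)" for x
  proof (rule field_le_epsilon)
    fix e :: real assume "0 < e"
    \<comment> \<open>The slack \<open>e'\<close> supplies the strict inequality demanded by
      \<open>A\<close>. The 1 in the denominator covers \<open>\<sigma> = 0\<close>, which is
      excluded only afterwards.\<close>
    define e' where "e' = e / (\<sigma> + 1)"
    have \<sigma>: "0 \<le> \<sigma>"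
      unfolding \<sigma>_def by (intro sum_nonneg \<delta>0)
    have "0 < e'"
      using \<open>0 < e\<close> \<sigma> by (simp add: e'_def)
    then have "0 \<le> (\<Sum>j\<in>UNIV. \<delta> $ j * (\<chi> j. p j x - v + e') $ j) + (\<Sum>i\<in>UNIV. lam $ i * (\<chi> i. g i x) $ i)"
      by (intro sep[of x]) auto
    also have "\<dots> = (\<Sum>j\<in>UNIV. \<delta> $ j * (p j x - v)) + (\<Sum>i\<in>UNIV. lam $ i * g i x) + \<sigma> * e'"
      unfolding \<sigma>_def by (simp add: distrib_left sum.distrib sum_distrib_right)
    also have "\<sigma> * e' \<le> e"
      using \<open>0 < e\<close> \<sigma> by (simp add: e'_def field_simps)
    finally show "0 \<le> (\<Sum>j\<in>UNIV. \<delta> $ j * (p j x - v)) + (\<Sum>i\<in>UNIV. lam $ i * g i x) + e"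
      by simp
  qed
  \<comment> \<open>Without weight on the objectives some constraint would have positive weight, and
    \<open>lagrange\<close> would fail at the Slater point.\<close>
  have "\<sigma> \<noteq> 0"
  proof
    assume "\<sigma> = 0"
    then have "\<delta> $ j = 0" for j
      using \<delta>0 unfolding \<sigma>_def by (simp add: sum_nonneg_eq_0_iff)
    then have "\<delta> = 0"
      by (simp add: vec_eq_iff)
    with \<open>c \<noteq> 0\<close> c_eq obtain k where "lam $ k \<noteq> 0"
      by (auto simp: vec_eq_iff zero_prod_def)
    have "(\<Sum>i\<in>UNIV. lam $ i * g i x0) < (\<Sum>i\<in>(UNIV :: 'm set). 0)"
    proof (rule sum_strict_mono_ex1)
      show "\<forall>i\<in>UNIV. lam $ i * g i x0 \<le> 0"
        using lam0 slater by (auto intro: mult_nonneg_nonpos less_imp_le)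
      show "\<exists>i\<in>UNIV. lam $ i * g i x0 < 0"
        using lam0[of k] \<open>lam $ k \<noteq> 0\<close> slater[of k] by (intro bexI[of _ k] mult_pos_neg) auto
    qed simp
    with lagrange[of x0] \<open>\<delta> = 0\<close> show False
      by simp
  qed
  then have \<sigma>: "0 < \<sigma>"
    using \<delta>0 unfolding \<sigma>_def by (simp add: sum_nonneg order.not_eq_order_implies_strict)
  show ?thesis
  proof (intro bexI allI)
    show "\<delta> /\<^sub>R \<sigma> \<in> unit_simplex"
      using \<delta>0 \<sigma> by (simp add: unit_simplex_def nonneg_orthant_def \<sigma>_def flip: sum_distrib_left)
    show "lam /\<^sub>R \<sigma> \<in> nonneg_orthant"
      using lam0 \<sigma> by (simp add: nonneg_orthant_def)
    fix x
    have "\<sigma> * v \<le> (\<Sum>j\<in>UNIV. \<delta> $ j * p j x) + (\<Sum>i\<in>UNIV. lam $ i * g i x)"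
      using lagrange[of x] by (simp add: right_diff_distrib sum_subtractf \<sigma>_def sum_distrib_right)
    then have "v \<le> ((\<Sum>j\<in>UNIV. \<delta> $ j * p j x) + (\<Sum>i\<in>UNIV. lam $ i * g i x)) / \<sigma>"
      using \<sigma> by (simp add: pos_le_divide_eq mult.commute)
    also have "\<dots> = (\<Sum>j\<in>UNIV. (\<delta> /\<^sub>R \<sigma>) $ j * p j x) + (\<Sum>i\<in>UNIV. (lam /\<^sub>R \<sigma>) $ i * g i x)"
      by (simp add: distrib_left sum_distrib_left divide_inverse mult_ac)
    finally show "v \<le> (\<Sum>j\<in>UNIV. (\<delta> /\<^sub>R \<sigma>) $ j * p j x) + (\<Sum>i\<in>UNIV. (lam /\<^sub>R \<sigma>) $ i * g i x)" .
  qed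
qed

section \<open>Weak and strong duality\<close>

lemma dual_value_le:
  assumes "\<mu> \<in> dual_values p g d" "x \<in> feasible_set g"
  shows "\<mu> \<le> (MAX j. eval_poly (p j) x)"
proof -
  obtain \<delta> lam where \<delta>: "\<delta> \<in> unit_simplex" and lam: "lam \<in> nonneg_orthant" and
    S: "(\<Sum>j\<in>UNIV. const_poly (\<delta> $ j) * p j) + (\<Sum>i\<in>UNIV. const_poly (lam $ i) * g i) - const_poly \<mu> \<in> SOS_le d"
    using assms(1) unfolding dual_values_def by blast
  have "0 \<le> (\<Sum>j\<in>UNIV. \<delta> $ j * eval_poly (p j) x) + (\<Sum>i\<in>UNIV. lam $ i * eval_poly (g i) x) - \<mu>"
  proof -
    have "sum_of_squares ((\<Sum>j\<in>UNIV. const_poly (\<delta> $ j) * p j) + (\<Sum>i\<in>UNIV. const_poly (lam $ i) * g i) - const_poly \<mu>)"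
      using S by (simp add: SOS_le_def)
    from eval_poly_sum_of_squares_nonneg[OF this, of x] show ?thesis
      by simp
  qed
  moreover have "(\<Sum>i\<in>UNIV. lam $ i * eval_poly (g i) x) \<le> 0"
    using lam assms(2)
    by (intro sum_nonpos mult_nonneg_nonpos) (auto simp: nonneg_orthant_def feasible_set_def)
  moreover have "(\<Sum>j\<in>UNIV. \<delta> $ j * eval_poly (p j) x) \<le> (\<Sum>j\<in>UNIV. \<delta> $ j * (MAX j. eval_poly (p j) x))"
    using \<delta> by (intro sum_mono mult_left_mono) (auto simp: unit_simplex_def nonneg_orthant_def)
  moreover have "(\<Sum>j\<in>UNIV. \<delta> $ j * (MAX j. eval_poly (p j) x)) = (MAX j. eval_poly (p j) x)"
    using \<delta> by (simp add: unit_simplex_def flip: sum_distrib_right)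
  ultimately show ?thesis
    by linarith
qed

lemma sup_D_le_inf_P: "sup_D p g d \<le> inf_P p g"
  unfolding sup_D_def inf_P_def by (intro SUP_least INF_greatest) (simp add: dual_value_le)

text \<open>Nonnegative multipliers keep the Lagrangian SOS-convex, so its nonnegativity upgrades to
  a sum of squares. The bound \<open>d\<close> is then a matter of the Lagrangian alone, whatever
  squares were found.\<close>

lemma inf_P_in_dual_values:
  fixes p :: "'r::finite \<Rightarrow> 'n::finite rpoly" and g :: "'m::finite \<Rightarrow> 'n rpoly"
  assumes p: "\<And>j. sos_convex (p j)" and g: "\<And>i. sos_convex (g i)"
    and deg: "\<And>j. poly_degree (p j) \<le> d" "\<And>i. poly_degree (g i) \<le> d"
    and slater: "\<And>i. eval_poly (g i) x0 < 0"
    and v: "inf_P p g = ereal v"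
  shows "v \<in> dual_values p g d"
proof -
  have "\<exists>j. v \<le> eval_poly (p j) x" if "\<And>i. eval_poly (g i) x \<le> 0" for x
  proof -
    have "ereal v \<le> ereal (MAX j. eval_poly (p j) x)"
      unfolding v[symmetric] inf_P_def using that by (intro INF_lower) (simp add: feasible_set_def)
    then have "v \<le> (MAX j. eval_poly (p j) x)"
      by simp
    then show ?thesis
      by (subst (asm) Max_ge_iff) auto
  qed
  from convex_minimax_multipliers[where p = "\<lambda>j. eval_poly (p j)" and g = "\<lambda>i. eval_poly (g i)",
      OF convex_on_eval_poly[OF p] convex_on_eval_poly[OF g] slater this]
  obtain \<delta> lam where \<delta>: "\<delta> \<in> unit_simplex" and lam: "lam \<in> nonneg_orthant" and
    le: "\<And>x. v \<le> (\<Sum>j\<in>UNIV. \<delta> $ j * eval_poly (p j) x) + (\<Sum>i\<in>UNIV. lam $ i * eval_poly (g i) x)"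
    by blast
  \<comment> \<open>Subtracting \<open>v\<close> is written as adding a constant polynomial, so that
    the closure rules for sums apply.\<close>
  define L where "L = (\<Sum>j\<in>UNIV. const_poly (\<delta> $ j) * p j) + (\<Sum>i\<in>UNIV. const_poly (lam $ i) * g i) + const_poly (- v)"
  have "sum_of_squares L"
  proof (rule sos_convex_nonneg_imp_sum_of_squares)
    show "sos_convex L"
      unfolding L_def using \<delta> lam
      by (intro sos_convex_add sos_convex_sum sos_convex_const_mult sos_convex_const p g)
         (auto simp: unit_simplex_def nonneg_orthant_def)
    show "0 \<le> eval_poly L x" for x
      using le[of x] by (simp add: L_def)
  qed
  moreover have "poly_degree L \<le> d"
    unfolding L_def
    by (intro poly_degree_add_le poly_degree_sum_le poly_degree_const_mult_le poly_degree_const deg)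
  ultimately have "L \<in> SOS_le d"
    by (simp add: SOS_le_def)
  then show ?thesis
    using \<delta> lam unfolding dual_values_def L_def const_poly_uminus by auto
qed

text \<open>If (P) is unbounded below, weak duality leaves (D) without a feasible point, so no real
  \<open>\<mu>\<close> can attain the common value; attainment is therefore claimed only away from
  \<open>-\<infinity>\<close>.\<close>

theorem theorem3p3:
  fixes p :: "'r::finite \<Rightarrow> 'n::finite rpoly"
    and g :: "'m::finite \<Rightarrow> 'n rpoly"
    and d :: nat
  assumes "\<And>j. sos_convex (p j)"
    and "\<And>i. sos_convex (g i)"
    and "feasible_set g \<noteq> {}"
    and "d = (LEAST k. even k \<and> max (MAX j. poly_degree (p j)) (MAX i. poly_degree (g i)) \<le> k)"
    and "{x. \<forall>i. eval_poly (g i) x < 0} \<noteq> {}"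
  shows "inf_P p g = sup_D p g d
    \<and> (inf_P p g \<noteq> -\<infinity> \<longrightarrow> (\<exists>\<mu> \<in> dual_values p g d. ereal \<mu> = sup_D p g d))"
proof (cases "inf_P p g = -\<infinity>")
  case True
  then show ?thesis
    using sup_D_le_inf_P[of p g d] by simp
next
  case False
  obtain y where "y \<in> feasible_set g"
    using assms(3) by blast
  then have "inf_P p g \<le> ereal (MAX j. eval_poly (p j) y)"
    unfolding inf_P_def by (rule INF_lower)
  with False obtain v where v: "inf_P p g = ereal v"
    by (cases "inf_P p g") auto
  define m where "m = max (MAX j. poly_degree (p j)) (MAX i. poly_degree (g i))"
  \<comment> \<open>The number \<open>2 * m\<close> shows that the condition under
    \<open>LEAST\<close> can be met, so \<open>d\<close> satisfies it.\<close>
  have "even (2 * m) \<and> m \<le> 2 * m"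
    by simp
  from LeastI[of "\<lambda>k. even k \<and> m \<le> k", OF this] have "m \<le> d"
    unfolding assms(4) m_def by blast
  then have "poly_degree (p j) \<le> d" "poly_degree (g i) \<le> d" for i j
    by (simp_all add: m_def)
  moreover obtain x0 where "\<And>i. eval_poly (g i) x0 < 0"
    using assms(5) by blast
  ultimately have "v \<in> dual_values p g d"
    using assms(1,2) v by (intro inf_P_in_dual_values)
  moreover from this have "inf_P p g \<le> sup_D p g d"
    unfolding v sup_D_def by (rule SUP_upper)
  then have "inf_P p g = sup_D p g d"
    using sup_D_le_inf_P[of p g d] by (rule antisym)
  ultimately show ?thesis
    using v by auto
qed

end
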